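(* For every fixed $k\in\mathbb{N}$ there exists a red-blue coloring of $\mathbb{N}$ such that for every $s\in\mathbb{N}$ the homogeneous arithmetic progression $A_{s,k}=\{s,2s,\dots,ks\}$ is perfectly balanced, i.e. the numbers of red and blue elements of $A_{s,k}$ differ by at most one.
   Context: $\mathbb{N}=\{1,2,3,\dots\}$. A red-blue coloring of a finite set $A$ is perfectly balanced if the numbers of red and blue elements in $A$ differ by at most one. For $s,k\in\mathbb{N}$, $A_{s,k}=\{s,2s,\dots,ks\}$. *)

theory Defs
  imports Main
begin

datatype colour = Red | Blue

definition perfectly_balanced :: "('a \<Rightarrow> colour) \<Rightarrow> 'a set \<Rightarrow> bool" where
  "perfectly_balanced c A \<longleftrightarrow>
     finite A \<and> \<bar>int (card {x \<in> A. c x = Red}) - int (card {x \<in> A. c x = Blue})\<bar> \<le> 1"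

(* For s >= 1 this set does not contain 0, so the value of a colouring at 0 plays no role. *)
definition hap :: "nat \<Rightarrow> nat \<Rightarrow> nat set" where
  "hap s k = (\<lambda>i. i * s) ` {1..k}"

end

(* Colour n by the sign f n of a completely multiplicative function with values 1 and -1: the
   imbalance of {s, 2s, ..., ks} is then |f s * (f 1 + ... + f k)| = |f 1 + ... + f k| for every s,
   so it suffices to find such an f whose partial sum at k is in {-1, 0, 1}.

   Start from the extension f of the nonprincipal character mod 4 with f 2 = 1. Its partial sums M
   count digit changes in binary, so 1 <= M m <= log_2 m + 1. The signs of the primes p with
   p^2 > k can be changed independently of each other, and p contributes (sign of p) * M (k div p).
   Choosing these signs greedily works if (i) the primes p = 1 (mod 4) among them have total weight
   at least M k / 2, and (ii) there are at least log_2 k primes in (k/2, k], all of weight 1, for the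
   fine adjustment. (ii) is Chebyshev's argument. For (i), let Lambda be the von Mangoldt function;
   the sum of Lambda d * f d * M (k div d) over d <= k is the sum of f n * ln n over n <= k, which is
   at least -O((log k)^2). Adding the sum of Lambda d * M (k div d), which is at least
   Lambda 1 + ... + Lambda k, only primes p = 1 (mod 4) survive, apart from the negligible d without
   a prime factor p with p^2 > k.

   The estimates are good for k >= 2^17. Below, flipping a few explicit primes in (k/2, k] is enough. *)

theory Submission
  imports Defs "HOL-Number_Theory.Number_Theory"
begin

section \<open>Completely multiplicative signs\<close>

text \<open>The completely multiplicative function with prescribed prime values. Encoding it by
  \<open>s\<close> turns the flip of a prime into a pointwise update of \<open>s\<close>.\<close>

definition cmult :: "(nat \<Rightarrow> int) \<Rightarrow> nat \<Rightarrow> int" where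
  "cmult s n = (\<Prod>p\<in>#prime_factorization n. s p)"

definition psum :: "(nat \<Rightarrow> int) \<Rightarrow> nat \<Rightarrow> int" where
  "psum s k = (\<Sum>n=1..k. cmult s n)"

definition large_primes :: "nat \<Rightarrow> nat set" where
  "large_primes k = {p. prime p \<and> p \<le> k \<and> k < p * p}"

lemma cmult_1 [simp]: "cmult s 1 = 1" "cmult s (Suc 0) = 1"
  by (simp_all add: cmult_def)

lemma cmult_prime: "prime p \<Longrightarrow> cmult s p = s p"
  by (simp add: cmult_def prime_factorization_prime)

lemma cmult_mult: "m > 0 \<Longrightarrow> n > 0 \<Longrightarrow> cmult s (m * n) = cmult s m * cmult s n"
  by (simp add: cmult_def prime_factorization_mult)

lemma cmult_cong:
  assumes "\<And>p. prime p \<Longrightarrow> p dvd n \<Longrightarrow> s p = s' p"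
  shows "cmult s n = cmult s' n"
  unfolding cmult_def
  by (intro arg_cong[where f = prod_mset] image_mset_cong) (use assms in auto)

lemma abs_cmult:
  assumes "\<And>p. prime p \<Longrightarrow> \<bar>s p\<bar> = 1"
  shows "\<bar>cmult s n\<bar> = 1"
proof -
  have "\<bar>prod_mset (image_mset s A)\<bar> = 1" if "\<And>p. p \<in># A \<Longrightarrow> prime p" for A
    using that by (induction A) (auto simp: abs_mult assms)
  thus ?thesis unfolding cmult_def by (auto intro: in_prime_factors_imp_prime)
qed

lemma psum_0 [simp]: "psum s 0 = 0"
  by (simp add: psum_def)

lemma psum_1 [simp]: "psum s (Suc 0) = 1"
  by (simp add: psum_def)

lemma colouring_of_psum:
  assumes s: "\<And>p. prime p \<Longrightarrow> \<bar>s p\<bar> = 1" and k: "\<bar>psum s k\<bar> \<le> 1"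
  shows "\<exists>c :: nat \<Rightarrow> colour. \<forall>t\<ge>1. perfectly_balanced c (hap t k)"
proof (intro exI allI impI)
  fix t :: nat
  assume t: "t \<ge> 1"
  define c where "c = (\<lambda>n. if cmult s n = 1 then Red else Blue)"
  let ?A = "hap t k"
  have fin: "finite ?A" by (simp add: hap_def)
  have sgn: "cmult s n = (if c n = Red then 1 else 0) - (if c n = Blue then 1 else 0)" for n
    using abs_cmult[of s n] s by (auto simp: c_def abs_if split: if_splits)
  have "int (card {x\<in>?A. c x = Red}) - int (card {x\<in>?A. c x = Blue}) = (\<Sum>x\<in>?A. cmult s x)"
    using fin by (subst sgn) (simp add: sum_subtractf sum.If_cases Int_def)
  also have "\<dots> = (\<Sum>i=1..k. cmult s (i * t))"
    unfolding hap_def using t by (subst sum.reindex) (auto simp: inj_on_def)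
  also have "\<dots> = (\<Sum>i=1..k. cmult s i * cmult s t)"
    using t by (intro sum.cong) (auto simp: cmult_mult)
  also have "\<dots> = psum s k * cmult s t"
    by (simp add: psum_def sum_distrib_right)
  finally show "perfectly_balanced (\<lambda>n. if cmult s n = 1 then Red else Blue) ?A"
    using fin k abs_cmult[of s t] s by (simp add: perfectly_balanced_def abs_mult c_def)
qed

lemma multiples_atMost:
  fixes d k :: nat
  assumes "d > 0"
  shows "{n\<in>{1..k}. d dvd n} = (\<lambda>m. d * m) ` {1..k div d}"
proof (intro equalityI subsetI)
  fix n assume "n \<in> {n\<in>{1..k}. d dvd n}"
  then obtain m where "n = d * m" "1 \<le> d * m" "d * m \<le> k" by auto
  thus "n \<in> (\<lambda>m. d * m) ` {1..k div d}"
    using assms by (intro image_eqI[of _ _ m]) (auto simp: less_eq_div_iff_mult_less_eq mult.commute Suc_le_eq)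
next
  fix n assume "n \<in> (\<lambda>m. d * m) ` {1..k div d}"
  thus "n \<in> {n\<in>{1..k}. d dvd n}"
    using assms by (auto simp: less_eq_div_iff_mult_less_eq mult.commute Suc_le_eq)
qed

lemma sum_multiples_cmult:
  assumes "d > 0"
  shows "(\<Sum>n\<in>{n\<in>{1..k}. d dvd n}. cmult s n) = cmult s d * psum s (k div d)"
proof -
  have "(\<Sum>n\<in>{n\<in>{1..k}. d dvd n}. cmult s n) = (\<Sum>m=1..k div d. cmult s (d * m))"
    unfolding multiples_atMost[OF assms]
    using assms by (subst sum.reindex) (auto simp: inj_on_def)
  also have "\<dots> = (\<Sum>m=1..k div d. cmult s d * cmult s m)"
    using assms by (intro sum.cong refl) (auto simp: cmult_mult)
  finally show ?thesis by (simp add: psum_def sum_distrib_left)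
qed

lemma finite_large_primes [simp]: "finite (large_primes k)"
  by (rule finite_subset[of _ "{..k}"]) (auto simp: large_primes_def)

lemma large_primes_prod:
  assumes "p \<in> large_primes k" "q \<in> large_primes k"
  shows "k < p * q"
proof (cases "p \<le> q")
  case True
  hence "p * p \<le> p * q" by simp
  with assms(1) show ?thesis unfolding large_primes_def by (blast intro: less_le_trans)
next
  case False
  hence "q * q \<le> p * q" by simp
  with assms(2) show ?thesis unfolding large_primes_def by (blast intro: less_le_trans)
qed

text \<open>Makes the weights constants: the values summed in \<open>psum s (k div p)\<close> do not
  involve the sign of any large prime, so flipping such primes leaves every weight
  unchanged.\<close>

lemma large_primes_cofactor:
  assumes p: "p \<in> large_primes k" and q: "q \<in> large_primes k" and m: "m \<in> {1..k div p}"
  shows "\<not> q dvd m"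
proof
  assume "q dvd m"
  hence "q \<le> m" using m by (auto intro: dvd_imp_le)
  also have "m \<le> k div p" using m by simp
  finally have "p * q \<le> p * (k div p)" by simp
  also have "\<dots> \<le> k" by simp
  finally show False using large_primes_prod[OF p q] by simp
qed

text \<open>A number up to \<open>k\<close> has at most one prime factor in \<open>large_primes k\<close>, and only to the first power.\<close>

lemma psum_large_primes:
  "psum s k = (\<Sum>n | n \<in> {1..k} \<and> (\<forall>p\<in>large_primes k. \<not> p dvd n). cmult s n)
     + (\<Sum>p\<in>large_primes k. s p * psum s (k div p))"
proof -
  let ?B = "\<lambda>p. {n\<in>{1..k}. p dvd n}"
  let ?A = "{n. n \<in> {1..k} \<and> (\<forall>p\<in>large_primes k. \<not> p dvd n)}"
  have disj: "?B p \<inter> ?B q = {}" if "p \<in> large_primes k" "q \<in> large_primes k" "p \<noteq> q" for p q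
  proof (rule ccontr)
    assume "?B p \<inter> ?B q \<noteq> {}"
    then obtain n where n: "n \<in> {1..k}" "p dvd n" "q dvd n" by blast
    have "coprime p q" using that by (auto simp: large_primes_def intro: primes_coprime)
    hence "p * q dvd n" using n by (simp add: divides_mult)
    hence "p * q \<le> k" using n by (auto dest: dvd_imp_le)
    thus False using large_primes_prod[OF that(1,2)] by simp
  qed
  have part: "(\<Sum>n\<in>?B p. cmult s n) = s p * psum s (k div p)" if "p \<in> large_primes k" for p
    using that sum_multiples_cmult[of p s k] by (simp add: large_primes_def cmult_prime prime_gt_0_nat)
  have "{1..k} = ?A \<union> (\<Union>p\<in>large_primes k. ?B p)" by auto
  hence "psum s k = (\<Sum>n\<in>?A \<union> (\<Union>p\<in>large_primes k. ?B p). cmult s n)"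
    unfolding psum_def by (rule arg_cong)
  also have "\<dots> = (\<Sum>n\<in>?A. cmult s n) + (\<Sum>n\<in>(\<Union>p\<in>large_primes k. ?B p). cmult s n)"
    by (rule sum.union_disjoint) auto
  also have "(\<Sum>n\<in>(\<Union>p\<in>large_primes k. ?B p). cmult s n) = (\<Sum>p\<in>large_primes k. \<Sum>n\<in>?B p. cmult s n)"
    using disj by (intro sum.UNION_disjoint) auto
  also have "\<dots> = (\<Sum>p\<in>large_primes k. s p * psum s (k div p))"
    using part by (intro sum.cong) auto
  finally show ?thesis .
qed

text \<open>In \<open>psum_large_primes\<close> both the first sum and the weights depend only on
  unchanged primes, so the partial sum is an affine function of the signs of the large
  primes.\<close>

lemma psum_change_signs:
  assumes eq: "\<And>p. prime p \<Longrightarrow> p \<notin> large_primes k \<Longrightarrow> s' p = s p"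
  shows "psum s' k = psum s k + (\<Sum>p\<in>large_primes k. (s' p - s p) * psum s (k div p))"
proof -
  have cong: "cmult s' n = cmult s n" if "\<forall>p\<in>large_primes k. \<not> p dvd n" for n
    using that eq by (intro cmult_cong) auto
  have "psum s' (k div p) = psum s (k div p)" if "p \<in> large_primes k" for p
    unfolding psum_def using that
    by (intro sum.cong refl cong ballI large_primes_cofactor)
  hence "psum s' k = (\<Sum>n | n \<in> {1..k} \<and> (\<forall>p\<in>large_primes k. \<not> p dvd n). cmult s n)
     + (\<Sum>p\<in>large_primes k. s' p * psum s (k div p))"
    by (subst psum_large_primes) (auto intro!: sum.cong cong)
  thus ?thesis
    by (subst (2) psum_large_primes)
       (simp add: sum_subtractf left_diff_distrib)
qed

section \<open>Choosing the signs of the large primes\<close>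

text \<open>Each new sign is chosen against the running total \<open>T\<close>. This replaces |T| by
  the distance between |T| and \<open>w p\<close>, which is at most \<open>W\<close> or else is |T|
  reduced by the full weight.\<close>

lemma greedy_signs:
  fixes w :: "'a \<Rightarrow> int"
  assumes "finite P" "\<And>p. p \<in> P \<Longrightarrow> 0 \<le> w p" "\<And>p. p \<in> P \<Longrightarrow> w p \<le> W"
  shows "\<exists>\<epsilon>. (\<forall>p. \<bar>\<epsilon> p :: int\<bar> = 1) \<and> \<bar>S + (\<Sum>p\<in>P. \<epsilon> p * w p)\<bar> \<le> max W (\<bar>S\<bar> - (\<Sum>p\<in>P. w p))"
  using assms
proof (induction P rule: finite_induct)
  case empty
  show ?case by (intro exI[of _ "\<lambda>_. 1"]) auto
next
  case (insert p P)
  then obtain \<epsilon> where \<epsilon>: "\<forall>p. \<bar>\<epsilon> p :: int\<bar> = 1"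
    "\<bar>S + (\<Sum>p\<in>P. \<epsilon> p * w p)\<bar> \<le> max W (\<bar>S\<bar> - (\<Sum>p\<in>P. w p))" by auto
  define T where "T = S + (\<Sum>p\<in>P. \<epsilon> p * w p)"
  define e :: int where "e = (if T > 0 then -1 else 1)"
  define \<epsilon>' where "\<epsilon>' = \<epsilon>(p := e)"
  have "(\<Sum>q\<in>P. \<epsilon>' q * w q) = (\<Sum>q\<in>P. \<epsilon> q * w q)"
    using insert.hyps by (intro sum.cong) (auto simp: \<epsilon>'_def)
  hence "S + (\<Sum>q\<in>insert p P. \<epsilon>' q * w q) = T + e * w p"
    using insert.hyps by (simp add: T_def \<epsilon>'_def)
  moreover have "0 \<le> w p" "w p \<le> W" using insert.prems by auto
  ultimately have "\<bar>S + (\<Sum>q\<in>insert p P. \<epsilon>' q * w q)\<bar> \<le> max W (\<bar>S\<bar> - (\<Sum>q\<in>insert p P. w q))"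
    using \<epsilon>(2) insert.hyps unfolding T_def[symmetric] by (auto simp: e_def)
  moreover have "\<forall>q. \<bar>\<epsilon>' q\<bar> = 1" using \<epsilon>(1) by (auto simp: \<epsilon>'_def e_def)
  ultimately show ?case by blast
qed

lemma upper_half_subset_large_primes: "{p. prime p \<and> p \<le> k \<and> k < 2 * p} \<subseteq> large_primes k"
proof
  fix p assume p: "p \<in> {p. prime p \<and> p \<le> k \<and> k < 2 * p}"
  hence "2 * p \<le> p * p" by (intro mult_right_mono prime_ge_2_nat) auto
  with p show "p \<in> large_primes k" unfolding large_primes_def by (blast intro: less_le_trans)
qed

lemma upper_half_div: "p \<le> k \<Longrightarrow> k < 2 * p \<Longrightarrow> k div p = (1::nat)"
  by (rule div_nat_eqI) auto

text \<open>Two greedy rounds. The primes up to k/2 bring the total down to at most the number of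
  primes in (k/2, k]; these have weight 1 and bring it down to at most 1.\<close>

lemma balance_greedily:
  assumes s: "\<And>p. prime p \<Longrightarrow> \<bar>s p\<bar> = 1"
    and w: "\<And>p. p \<in> large_primes k \<Longrightarrow> 0 \<le> psum s (k div p)"
      "\<And>p. p \<in> large_primes k \<Longrightarrow> psum s (k div p) \<le> W"
    and Q: "W \<le> int (card {p. prime p \<and> p \<le> k \<and> k < 2 * p})"
    and up: "psum s k \<le> (\<Sum>p\<in>large_primes k. (1 + s p) * psum s (k div p))"
    and lo: "- psum s k \<le> (\<Sum>p\<in>large_primes k. (1 - s p) * psum s (k div p))"
  shows "\<exists>s'. (\<forall>p. prime p \<longrightarrow> \<bar>s' p\<bar> = 1) \<and> \<bar>psum s' k\<bar> \<le> 1"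
proof -
  let ?w = "\<lambda>p. psum s (k div p)"
  let ?Q = "{p. prime p \<and> p \<le> k \<and> k < 2 * p}"
  let ?P = "large_primes k - ?Q"
  note sub = upper_half_subset_large_primes[of k]
  have finQ: "finite ?Q" using sub by (rule finite_subset) simp
  have wQ: "?w p = 1" if "p \<in> ?Q" for p using that upper_half_div[of p k] by simp
  have split: "(\<Sum>p\<in>large_primes k. g p) = (\<Sum>p\<in>?P. g p) + (\<Sum>p\<in>?Q. g p)" for g :: "nat \<Rightarrow> int"
    by (rule sum.subset_diff[OF sub]) simp
  \<comment> \<open>By \<open>psum_large_primes\<close>, \<open>S\<close> is the sum over the
    numbers without a large prime factor. The hypotheses \<open>up\<close> and \<open>lo\<close> say
    exactly that |S| is at most the total weight of the large primes.\<close>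
  define S where "S = psum s k - (\<Sum>p\<in>large_primes k. s p * ?w p)"
  have "\<bar>S\<bar> \<le> (\<Sum>p\<in>large_primes k. ?w p)"
    using up lo by (simp add: S_def ring_distribs sum.distrib sum_subtractf abs_le_iff)
  hence S: "\<bar>S\<bar> - (\<Sum>p\<in>?P. ?w p) \<le> int (card ?Q)"
    using wQ by (simp add: split)
  obtain \<epsilon> where \<epsilon>: "\<forall>p. \<bar>\<epsilon> p :: int\<bar> = 1"
    "\<bar>S + (\<Sum>p\<in>?P. \<epsilon> p * ?w p)\<bar> \<le> max W (\<bar>S\<bar> - (\<Sum>p\<in>?P. ?w p))"
    using greedy_signs[of ?P ?w W S] w by auto
  define T where "T = S + (\<Sum>p\<in>?P. \<epsilon> p * ?w p)"
  have T: "\<bar>T\<bar> \<le> int (card ?Q)" using \<epsilon>(2) S Q by (simp add: T_def)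
  obtain \<delta> where \<delta>: "\<forall>p. \<bar>\<delta> p :: int\<bar> = 1"
    "\<bar>T + (\<Sum>p\<in>?Q. \<delta> p * ?w p)\<bar> \<le> max 1 (\<bar>T\<bar> - (\<Sum>p\<in>?Q. ?w p))"
    using greedy_signs[of ?Q ?w 1 T] finQ wQ by auto
  define s' where "s' = (\<lambda>p. if p \<in> ?Q then \<delta> p else if p \<in> large_primes k then \<epsilon> p else s p)"
  have "psum s' k = psum s k + (\<Sum>p\<in>large_primes k. (s' p - s p) * ?w p)"
    using sub by (intro psum_change_signs) (auto simp: s'_def)
  also have "\<dots> = S + (\<Sum>p\<in>large_primes k. s' p * ?w p)"
    by (simp add: S_def left_diff_distrib sum_subtractf)
  also have "\<dots> = S + (\<Sum>p\<in>?P. s' p * ?w p) + (\<Sum>p\<in>?Q. s' p * ?w p)"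
    by (simp add: split)
  also have "(\<Sum>p\<in>?P. s' p * ?w p) = (\<Sum>p\<in>?P. \<epsilon> p * ?w p)"
    by (intro sum.cong) (auto simp: s'_def)
  also have "(\<Sum>p\<in>?Q. s' p * ?w p) = (\<Sum>p\<in>?Q. \<delta> p * ?w p)"
    by (intro sum.cong) (auto simp: s'_def)
  finally have "\<bar>psum s' k\<bar> \<le> max 1 (\<bar>T\<bar> - (\<Sum>p\<in>?Q. ?w p))"
    using \<delta>(2) by (simp add: T_def)
  also have "(\<Sum>p\<in>?Q. ?w p) = int (card ?Q)" using wQ by simp
  finally have "\<bar>psum s' k\<bar> \<le> 1" using T by simp
  moreover have "\<forall>p. prime p \<longrightarrow> \<bar>s' p\<bar> = 1" using s \<epsilon>(1) \<delta>(1) by (simp add: s'_def)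
  ultimately show ?thesis by blast
qed

section \<open>The character modulo 4\<close>

text \<open>On odd primes this is the nonprincipal character modulo 4. The character vanishes at 2,
  so the sign \<open>e\<close> there is free: 1 in the general argument, -1 for k < 44.\<close>

definition chi :: "int \<Rightarrow> nat \<Rightarrow> int" where
  "chi e p = (if p = 2 then e else if p mod 4 = 1 then 1 else -1)"

lemma cmult_chi_odd:
  assumes "odd n"
  shows "cmult (chi e) n = (if n mod 4 = 1 then 1 else -1)"
  using assms
proof (induction n rule: prime_divisors_induct)
  case (factor p x)
  have "p \<noteq> 2" "odd p" "odd x" using factor by auto
  have x0: "x > 0" "p > 0" using \<open>odd x\<close> \<open>odd p\<close> by (auto intro: Nat.gr0I)
  have "cmult (chi e) (p * x) = chi e p * (if x mod 4 = 1 then 1 else -1)"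
    using factor \<open>odd x\<close> x0 by (simp add: cmult_mult cmult_prime)
  moreover have "p mod 4 = 1 \<or> p mod 4 = 3" "x mod 4 = 1 \<or> x mod 4 = 3"
    using \<open>odd x\<close> \<open>odd p\<close> by presburger+
  moreover have "p * x mod 4 = (p mod 4) * (x mod 4) mod 4" by (simp add: mod_mult_eq)
  ultimately show ?case using \<open>p \<noteq> 2\<close> by (auto simp: chi_def[of e p])
next
  case (unit x)
  then show ?case by simp
qed auto

lemma sum_even_odd:
  fixes g :: "nat \<Rightarrow> 'a::comm_monoid_add"
  shows "(\<Sum>n=1..k. g n) = (\<Sum>m=1..k div 2. g (2 * m)) + (\<Sum>n | n \<in> {1..k} \<and> odd n. g n)"
proof -
  have "{n. n \<in> {1..k} \<and> even n} = (\<lambda>m. 2 * m) ` {1..k div 2}"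
    by (auto elim!: evenE)
  hence "(\<Sum>n | n \<in> {1..k} \<and> even n. g n) = (\<Sum>m=1..k div 2. g (2 * m))"
    by (simp add: sum.reindex inj_on_def)
  moreover have "(\<Sum>n=1..k. g n) = (\<Sum>n | n \<in> {1..k} \<and> even n. g n) + (\<Sum>n | n \<in> {1..k} \<and> odd n. g n)"
    by (subst sum.union_disjoint [symmetric]) (auto intro!: sum.cong)
  ultimately show ?thesis by simp
qed

lemma sum_odd_Suc:
  fixes g :: "nat \<Rightarrow> 'a::comm_monoid_add"
  shows "(\<Sum>n | n \<in> {1..Suc k} \<and> odd n. g n) =
    (\<Sum>n | n \<in> {1..k} \<and> odd n. g n) + (if even k then g (Suc k) else 0)"
proof (cases "even k")
  case True
  hence "{n. n \<in> {1..Suc k} \<and> odd n} = insert (Suc k) {n. n \<in> {1..k} \<and> odd n}" by (auto simp: le_Suc_eq)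
  thus ?thesis using True by (simp add: add.commute)
next
  case False
  hence "{n. n \<in> {1..Suc k} \<and> odd n} = {n. n \<in> {1..k} \<and> odd n}" by (auto simp: le_Suc_eq)
  thus ?thesis using False by simp
qed

text \<open>Even numbers 2m reproduce the sum up to \<open>k div 2\<close> with factor
  \<open>e\<close>. The odd ones contribute 1, -1, 1, -1, ..., which leaves 1 exactly when the last
  two binary digits of k differ.\<close>

lemma psum_chi_rec:
  "psum (chi e) k = e * psum (chi e) (k div 2) + (if k mod 4 = 1 \<or> k mod 4 = 2 then 1 else 0)"
proof -
  have "(\<Sum>n | n \<in> {1..k} \<and> odd n. cmult (chi e) n) = (if k mod 4 = 1 \<or> k mod 4 = 2 then 1 else 0)"
  proof (induction k)
    case (Suc k)
    have "k mod 4 = 0 \<or> k mod 4 = 1 \<or> k mod 4 = 2 \<or> k mod 4 = 3" by presburger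
    thus ?case
      unfolding sum_odd_Suc Suc.IH
      by (elim disjE) (auto simp: cmult_chi_odd mod_Suc, presburger+)
  qed simp
  moreover have "(\<Sum>m=1..k div 2. cmult (chi e) (2 * m)) = (\<Sum>m=1..k div 2. e * cmult (chi e) m)"
    by (intro sum.cong refl) (auto simp: cmult_mult cmult_prime chi_def)
  ultimately show ?thesis
    unfolding psum_def by (subst sum_even_odd) (simp add: sum_distrib_left)
qed

lemma psum_chi_pos: "k > 0 \<Longrightarrow> psum (chi 1) k \<ge> 1"
proof (induction k rule: less_induct)
  case (less k)
  show ?case
  proof (cases "k = 1")
    case False
    hence "psum (chi 1) (k div 2) \<ge> 1" using less by (intro less.IH) auto
    thus ?thesis by (subst psum_chi_rec) simp
  qed simp
qed

lemma psum_chi_le: "k < 2 ^ J \<Longrightarrow> psum (chi 1) k \<le> int J"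
proof (induction J arbitrary: k)
  case (Suc J)
  hence "psum (chi 1) (k div 2) \<le> int J" by (intro Suc.IH) auto
  thus ?case by (subst psum_chi_rec) simp
qed simp

section \<open>Chebyshev-type estimates\<close>

text \<open>Write ln n as the sum of \<open>mangoldt d\<close> over the divisors d of n and exchange
  the summations. The constant sign 1 gives Legendre's formula for ln k!, and \<open>chi 1\<close>
  gives the twisted sum.\<close>

lemma sum_cmult_ln:
  "(\<Sum>n=1..k. of_int (cmult s n) * ln (real n)) =
     (\<Sum>d=1..k. mangoldt d * of_int (cmult s d * psum s (k div d)))"
proof -
  have ln: "ln (real n) = (\<Sum>d\<in>{d\<in>{1..k}. d dvd n}. mangoldt d)" if n: "n \<in> {1..k}" for n
  proof -
    have "{d\<in>{1..k}. d dvd n} = {d. d dvd n}" using n by (auto dest: dvd_imp_le intro: Nat.gr0I)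
    thus ?thesis using n by (simp add: mangoldt_sum)
  qed
  have "(\<Sum>n=1..k. of_int (cmult s n) * ln (real n)) =
      (\<Sum>n=1..k. \<Sum>d\<in>{d\<in>{1..k}. d dvd n}. of_int (cmult s n) * mangoldt d)"
    by (intro sum.cong refl) (simp add: ln sum_distrib_left del: atLeastAtMost_iff)
  also have "\<dots> = (\<Sum>d=1..k. \<Sum>n\<in>{n\<in>{1..k}. d dvd n}. of_int (cmult s n) * mangoldt d)"
    by (rule sum.swap_restrict) auto
  also have "\<dots> = (\<Sum>d=1..k. mangoldt d * of_int (\<Sum>n\<in>{n\<in>{1..k}. d dvd n}. cmult s n))"
    by (simp add: sum_distrib_left mult.commute)
  also have "\<dots> = (\<Sum>d=1..k. mangoldt d * of_int (cmult s d * psum s (k div d)))"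
    by (intro sum.cong refl, subst sum_multiples_cmult) auto
  finally show ?thesis .
qed

lemma cmult_const_1 [simp]: "cmult (\<lambda>_. 1) n = 1"
  by (simp add: cmult_def)

text \<open>The free upper limit \<open>N\<close> puts the three factorials of a binomial
  coefficient over one range of d; the additional terms have \<open>n div d = 0\<close>.\<close>

lemma ln_fact_mangoldt:
  assumes "n \<le> N"
  shows "ln (fact n) = (\<Sum>d=1..N. mangoldt d * real (n div d))"
proof -
  have "ln (fact n :: real) = (\<Sum>d=1..n. mangoldt d * real (n div d))"
  proof -
    have "ln (fact n :: real) = (\<Sum>d=1..n. ln (real d))"
      unfolding fact_prod of_nat_prod by (subst ln_prod) auto
    thus ?thesis using sum_cmult_ln[of "\<lambda>_. 1" n] by (simp add: psum_def)
  qed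
  also have "\<dots> = (\<Sum>d=1..N. mangoldt d * real (n div d))"
    using assms by (intro sum.mono_neutral_left) (auto simp: not_le)
  finally show ?thesis .
qed

lemma ln_binomial_mangoldt:
  "ln (real ((a + b) choose a)) =
     (\<Sum>d=1..a+b. mangoldt d * (real ((a + b) div d) - real (a div d) - real (b div d)))"
proof -
  have "real ((a + b) choose a) = fact (a + b) / (fact a * fact b)"
    by (simp add: binomial_fact)
  hence "ln (real ((a + b) choose a)) = ln (fact (a + b)) - ln (fact a) - ln (fact b)"
    by (simp add: ln_div ln_mult)
  thus ?thesis
    by (simp add: ln_fact_mangoldt[where N = "a + b"] right_diff_distrib sum_subtractf)
qed

text \<open>Every coefficient of \<open>mangoldt d\<close> in \<open>ln_binomial_mangoldt\<close> is
  therefore 0 or 1.\<close>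

lemma div_add_bounds:
  fixes a b d :: nat
  shows "a div d + b div d \<le> (a + b) div d" "(a + b) div d \<le> a div d + b div d + 1"
proof -
  show "a div d + b div d \<le> (a + b) div d"
    by (simp add: div_add1_eq[of a b d])
  show "(a + b) div d \<le> a div d + b div d + 1"
  proof (cases "d = 0")
    case False
    have "a mod d < d" "b mod d < d" using False by auto
    hence "a mod d + b mod d < 2 * d" by linarith
    hence "(a mod d + b mod d) div d < 2" using False by (simp add: div_less_iff_less_mult)
    thus ?thesis by (simp add: div_add1_eq[of a b d])
  qed simp
qed

text \<open>For a < d <= a + b both \<open>a div d\<close> and \<open>b div d\<close> vanish, so
  these d have coefficient at least 1 in the binomial; all other coefficients are
  nonnegative.\<close>

lemma mangoldt_sum_le_ln_binomial:
  assumes "b \<le> a"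
  shows "(\<Sum>d=1..a+b. mangoldt d) - (\<Sum>d=1..a. mangoldt d) \<le> ln (real ((a + b) choose a))"
proof -
  have "(\<Sum>d=1..a+b. mangoldt d :: real) - (\<Sum>d=1..a. mangoldt d) = (\<Sum>d=1..a+b. if d \<le> a then 0 else mangoldt d)"
  proof -
    have "(\<Sum>d=1..a. mangoldt d :: real) = (\<Sum>d=1..a+b. if d \<le> a then mangoldt d else 0)"
      by (intro sum.mono_neutral_cong_left) auto
    thus ?thesis by (simp flip: sum_subtractf) (auto intro!: sum.cong)
  qed
  also have "\<dots> \<le> ln (real ((a + b) choose a))"
    unfolding ln_binomial_mangoldt
  proof (intro sum_mono)
    fix d assume d: "d \<in> {1..a+b}"
    have "real (a div d) + real (b div d) \<le> real ((a + b) div d)"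
      using div_add_bounds(1)[of a d b] by linarith
    moreover have "(a + b) div d \<ge> 1" using d by (simp add: Suc_le_eq div_greater_zero_iff)
    ultimately show "(if d \<le> a then 0 else mangoldt d) \<le>
        mangoldt d * (real ((a + b) div d) - real (a div d) - real (b div d))"
      using assms mangoldt_nonneg[of d] mult_left_mono[of 1 "real ((a + b) div d)" "mangoldt d"] by auto
  qed
  finally show ?thesis .
qed

lemma binomial_central_le: "(n + n) choose n \<le> 4 ^ n"
  using binomial_le_pow2[of "n + n" n] by (simp add: power_add flip: power_mult_distrib)

text \<open>The two middle entries of row 2n + 1 are equal and together at most the row sum 2 *
  4^n.\<close>

lemma binomial_odd_central_le: "(Suc n + n) choose Suc n \<le> 4 ^ n"
proof -
  have "(\<Sum>j\<in>{n, Suc n}. (Suc n + n) choose j) \<le> (\<Sum>j\<le>Suc n + n. (Suc n + n) choose j)"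
    by (rule sum_mono2) auto
  also have "\<dots> = 2 * 4 ^ n" unfolding choose_row_sum by (simp add: power_add flip: power_mult_distrib)
  finally show ?thesis using binomial_symmetric[of n "Suc n + n"] by simp
qed

text \<open>Chebyshev's upper bound by halving: passing from n/2, rounded up, to n costs at most the
  logarithm of a middle binomial coefficient, which is at most \<open>n div 2\<close> times ln
  4.\<close>

lemma mangoldt_sum_upper:
  assumes "n \<ge> 1"
  shows "(\<Sum>d=1..n. mangoldt d) \<le> (real n - 1) * ln 4"
  using assms
proof (induction n rule: less_induct)
  case (less n)
  have "n = n div 2 + n div 2 \<or> n = Suc (n div 2) + n div 2" by presburger
  then consider "n = 1" | m where "n = m + m" "m \<ge> 1" | m where "n = Suc m + m" "m \<ge> 1"
    using less.prems by (cases "n div 2 = 0") (fastforce simp: Suc_le_eq)+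
  thus ?case
  proof cases
    case 2
    have "(\<Sum>d=1..n. mangoldt d) \<le> (\<Sum>d=1..m. mangoldt d) + ln (real (n choose m))"
      using mangoldt_sum_le_ln_binomial[of m m] 2 by simp
    also have "(\<Sum>d=1..m. mangoldt d) \<le> (real m - 1) * ln 4" using 2 by (intro less.IH) auto
    also have "ln (real (n choose m)) \<le> ln (4 ^ m)"
      unfolding 2(1) using of_nat_mono[OF binomial_central_le[of m], where 'a = real]
      by (subst ln_le_cancel_iff) auto
    finally show ?thesis using 2 by (simp add: ln_realpow algebra_simps)
  next
    case 3
    have "(\<Sum>d=1..n. mangoldt d) \<le> (\<Sum>d=1..Suc m. mangoldt d) + ln (real (n choose Suc m))"
      using mangoldt_sum_le_ln_binomial[of m "Suc m"] 3 by simp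
    also have "(\<Sum>d=1..Suc m. mangoldt d) \<le> (real (Suc m) - 1) * ln 4" using 3 by (intro less.IH) auto
    also have "ln (real (n choose Suc m)) \<le> ln (4 ^ m)"
      unfolding 3(1) using of_nat_mono[OF binomial_odd_central_le[of m], where 'a = real]
      by (subst ln_le_cancel_iff) (auto simp del: binomial_Suc_Suc simp: zero_less_binomial)
    finally show ?thesis using 3 by (simp add: ln_realpow algebra_simps)
  qed simp
qed

lemma ln_central_binomial_lower:
  assumes "n \<ge> 1"
  shows "real n * ln 4 - ln (2 * real n) \<le> ln (real ((n + n) choose n))"
proof -
  have "real n * ln 4 - ln (2 * real n) = ln (4 ^ n / (2 * real n))"
    using assms by (subst ln_div) (auto simp: ln_realpow)
  also have "\<dots> \<le> ln (real ((n + n) choose n))"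
    using central_binomial_lower_bound[of n] assms
    unfolding mult_2[of n] by (intro ln_mono) auto
  finally show ?thesis .
qed

lemma mangoldt_sum_lower:
  assumes "n \<ge> 1"
  shows "real n * ln 4 - ln (2 * real n) \<le> (\<Sum>d=1..n+n. mangoldt d)"
proof -
  have "ln (real ((n + n) choose n)) \<le> (\<Sum>d=1..n+n. mangoldt d)"
    unfolding ln_binomial_mangoldt
  proof (intro sum_mono)
    fix d
    have "real ((n + n) div d) - real (n div d) - real (n div d) \<le> 1"
      using div_add_bounds(2)[of n n d] by linarith
    from mult_left_mono[OF this mangoldt_nonneg[of d]]
    show "mangoldt d * (real ((n + n) div d) - real (n div d) - real (n div d)) \<le> mangoldt d" by simp
  qed
  thus ?thesis using ln_central_binomial_lower[OF assms] by simp
qed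

text \<open>Erdos's observation: for 2n/3 < d <= n the coefficient is 2 - 1 - 1 = 0. The d up to
  2n/3 account for at most 2n/3 * ln 4 by \<open>mangoldt_sum_upper\<close>, and n/3 * ln 4 remains
  for d > n.\<close>

lemma mangoldt_sum_upper_half:
  assumes "n \<ge> 2"
  shows "real n / 3 * ln 4 - ln (2 * real n) \<le> (\<Sum>d=n+1..n+n. mangoldt d)"
proof -
  let ?c = "\<lambda>d. (real ((n + n) div d) - real (n div d) - real (n div d)) :: real"
  let ?m = "(2 * n) div 3"
  have "ln (real ((n + n) choose n)) \<le> (\<Sum>d=1..n+n. (if d \<le> ?m then mangoldt d else 0) + (if n < d then mangoldt d else 0))"
    unfolding ln_binomial_mangoldt
  proof (intro sum_mono)
    fix d assume d: "d \<in> {1..n+n}"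
    have le1: "?c d \<le> 1" using div_add_bounds(2)[of n n d] by linarith
    have "mangoldt d * ?c d \<le> mangoldt d" using mult_left_mono[OF le1 mangoldt_nonneg[of d]] by simp
    moreover have "?c d = 0" if "\<not> d \<le> ?m" "\<not> n < d"
    proof -
      have "n div d = 1" using that d by (intro div_nat_eqI) auto
      moreover have "(n + n) div d = 2" using that d by (intro div_nat_eqI) auto
      ultimately show ?thesis by simp
    qed
    ultimately show "mangoldt d * ?c d \<le> (if d \<le> ?m then mangoldt d else 0) + (if n < d then mangoldt d else 0)"
      using mangoldt_nonneg[of d] by auto
  qed
  also have "\<dots> = (\<Sum>d=1..?m. mangoldt d) + (\<Sum>d=n+1..n+n. mangoldt d)"
    unfolding sum.distrib
    by (intro arg_cong2[where f = "(+)"] sum.mono_neutral_cong_right) auto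
  also have "(\<Sum>d=1..?m. mangoldt d) \<le> (real ?m - 1) * ln 4"
    using assms by (intro mangoldt_sum_upper) auto
  also have "\<dots> \<le> 2 * real n / 3 * ln 4"
    by (intro mult_right_mono) auto
  finally show ?thesis using ln_central_binomial_lower[of n] assms by (simp add: algebra_simps)
qed

text \<open>Only powers of primes p with p^2 <= k remain. Each such p contributes at most ln k in
  total, and there are at most (sqrt k + 1)/2 of them, since all but 2 are odd and at least
  3.\<close>

lemma mangoldt_sum_not_large_primes:
  assumes "k \<ge> 1"
  shows "(\<Sum>d\<in>{1..k} - large_primes k. mangoldt d) \<le> (sqrt (real k) + 1) / 2 * ln (real k)"
proof -
  define P where "P = {p. prime p \<and> p * p \<le> k}"
  define A where "A = (\<lambda>p. {a. 1 \<le> a \<and> p ^ a \<le> k})"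
  \<comment> \<open>The number of odd integers 2i + 1 from 3 up to sqrt k.\<close>
  define N where "N = nat \<lfloor>(sqrt (real k) - 1) / 2\<rfloor>"
  have P_sub: "P \<subseteq> insert 2 ((\<lambda>i. 2 * i + 1) ` {1..N})"
  proof
    fix p assume p: "p \<in> P"
    hence "real p * real p \<le> real k" unfolding P_def by (simp flip: of_nat_mult)
    hence le: "real p \<le> sqrt (real k)" by (intro real_le_rsqrt) (simp add: power2_eq_square)
    show "p \<in> insert 2 ((\<lambda>i. 2 * i + 1) ` {1..N})"
    proof (cases "p = 2")
      case False
      have "p > 2" using False p prime_ge_2_nat[of p] by (auto simp: P_def)
      hence "odd p" using p prime_odd_nat by (auto simp: P_def)
      then obtain i where i: "p = 2 * i + 1" by (rule oddE)
      hence "real i \<le> (sqrt (real k) - 1) / 2" using le by simp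
      hence "i \<in> {1..N}" using i \<open>p > 2\<close> by (auto simp: N_def intro: le_nat_floor)
      thus ?thesis using i by blast
    qed simp
  qed
  have finP: "finite P" using P_sub by (rule finite_subset) simp
  have cardP: "real (card P) \<le> (sqrt (real k) + 1) / 2"
  proof -
    have "card P \<le> card (insert 2 ((\<lambda>i. 2 * i + 1) ` {1..N}))" by (rule card_mono[OF _ P_sub]) simp
    also have "\<dots> \<le> Suc (card ((\<lambda>i. 2 * i + 1) ` {1..N}))" by (rule card_insert_le_m1) auto
    also have "\<dots> \<le> Suc N" using card_image_le[of "{1..N}" "\<lambda>i. 2 * i + 1"] by simp
    finally have "real (card P) \<le> 1 + real N" by simp
    moreover have "real N \<le> (sqrt (real k) - 1) / 2" unfolding N_def using assms by (intro of_nat_floor) simp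
    ultimately show ?thesis by (simp add: field_simps)
  qed
  have A_sub: "A p \<subseteq> {1..nat \<lfloor>ln (real k) / ln (real p)\<rfloor>}" if "p \<in> P" for p
  proof
    fix a assume a: "a \<in> A p"
    have p: "real p > 1" using that by (auto simp: P_def prime_gt_Suc_0_nat)
    have "real (p ^ a) \<le> real k" using a unfolding A_def by (simp only: mem_Collect_eq of_nat_le_iff)
    hence "ln (real p ^ a) \<le> ln (real k)" using p by (subst ln_le_cancel_iff) (use assms in auto)
    hence "real a \<le> ln (real k) / ln (real p)" using p by (simp add: ln_realpow pos_le_divide_eq)
    thus "a \<in> {1..nat \<lfloor>ln (real k) / ln (real p)\<rfloor>}" using a by (auto simp: A_def le_nat_iff le_floor_iff)
  qed
  have finA: "finite (A p)" if "p \<in> P" for p using A_sub[OF that] by (rule finite_subset) simp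
  have "(\<Sum>d\<in>{1..k} - large_primes k. mangoldt d :: real) =
      (\<Sum>d\<in>{d\<in>{1..k} - large_primes k. primepow d}. mangoldt d)"
    by (intro sum.mono_neutral_right) (auto simp: mangoldt_def)
  also have "\<dots> \<le> (\<Sum>(p, a)\<in>Sigma P A. ln (real p))"
  proof (rule sum_le_included[where i = "\<lambda>(p, a). p ^ a"])
    show "\<forall>d\<in>{d\<in>{1..k} - large_primes k. primepow d}.
        \<exists>y\<in>Sigma P A. (case y of (p, a) \<Rightarrow> p ^ a) = d \<and> mangoldt d \<le> (case y of (p, a) \<Rightarrow> ln (real p))"
    proof
      fix d assume d: "d \<in> {d\<in>{1..k} - large_primes k. primepow d}"
      then obtain p a where pa: "prime p" "a > 0" "d = p ^ a"
        by (auto simp: primepow_def)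
      \<comment> \<open>A prime itself has p^2 <= k because it is not large; for an exponent of at
        least 2, p^2 divides d <= k.\<close>
      have "p * p \<le> k"
      proof (cases "a = 1")
        case True
        thus ?thesis using d pa by (auto simp: large_primes_def)
      next
        case False
        hence "p ^ 2 \<le> p ^ a" using pa by (intro power_increasing) (auto simp: prime_ge_Suc_0_nat)
        thus ?thesis using d pa by (simp add: power2_eq_square)
      qed
      hence "(p, a) \<in> Sigma P A" using d pa by (auto simp: P_def A_def)
      thus "\<exists>y\<in>Sigma P A. (case y of (p, a) \<Rightarrow> p ^ a) = d \<and> mangoldt d \<le> (case y of (p, a) \<Rightarrow> ln (real p))"
        using pa by (intro bexI[of _ "(p, a)"]) auto
    qed
    show "\<forall>y\<in>Sigma P A. 0 \<le> (case y of (p, a) \<Rightarrow> ln (real p))"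
      by (auto simp: P_def intro!: ln_ge_zero dest: prime_ge_1_nat)
  qed (use finP finA in auto)
  also have "\<dots> = (\<Sum>p\<in>P. \<Sum>a\<in>A p. ln (real p))"
    using finP finA by (subst sum.Sigma) auto
  also have "\<dots> \<le> (\<Sum>p\<in>P. ln (real k))"
  proof (rule sum_mono)
    fix p assume p: "p \<in> P"
    hence p1: "real p > 1" by (auto simp: P_def prime_gt_Suc_0_nat)
    have "card (A p) \<le> nat \<lfloor>ln (real k) / ln (real p)\<rfloor>" using card_mono[OF _ A_sub[OF p]] by simp
    hence "real (card (A p)) \<le> real (nat \<lfloor>ln (real k) / ln (real p)\<rfloor>)" by simp
    also have "\<dots> \<le> ln (real k) / ln (real p)" using p1 assms by simp
    finally show "(\<Sum>a\<in>A p. ln (real p)) \<le> ln (real k)" using p1 by (simp add: pos_le_divide_eq)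
  qed
  also have "\<dots> \<le> (sqrt (real k) + 1) / 2 * ln (real k)"
    using mult_right_mono[OF cardP, of "ln (real k)"] assms by simp
  finally show ?thesis .
qed

section \<open>The logarithmic sum twisted by the character\<close>

text \<open>Along odd n the signs are 1, -1, 1, -1, .... For nondecreasing \<open>g\<close> the sum
  is nonnegative after a plus sign, and the next minus sign costs at most the current value of
  \<open>g\<close>.\<close>

lemma alternating_sum_lower:
  fixes g :: "nat \<Rightarrow> real"
  assumes mono: "\<And>n. g n \<le> g (Suc n)" and g0: "g 0 \<ge> 0"
  shows "(\<Sum>n | n \<in> {1..k} \<and> odd n. of_int (cmult (chi e) n) * g n) \<ge> (if k mod 4 = 1 \<or> k mod 4 = 2 then 0 else - g k)"
proof (induction k)
  case 0
  thus ?case using g0 by simp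
next
  case (Suc k)
  define A where "A = (\<Sum>n | n \<in> {1..k} \<and> odd n. of_int (cmult (chi e) n) * g n)"
  have IH: "A \<ge> (if k mod 4 = 1 \<or> k mod 4 = 2 then 0 else - g k)"
    unfolding A_def by (rule Suc.IH)
  have "(\<Sum>n | n \<in> {1..Suc k} \<and> odd n. of_int (cmult (chi e) n) * g n) =
      A + (if even k then of_int (if Suc k mod 4 = 1 then 1 else -1) * g (Suc k) else 0)"
    unfolding A_def sum_odd_Suc by (simp add: cmult_chi_odd)
  moreover have Suc_mod: "Suc k mod 4 = (if k mod 4 = 3 then 0 else Suc (k mod 4))"
    by (simp add: mod_Suc)
  moreover have "(k mod 4 = 0 \<and> even k) \<or> (k mod 4 = 1 \<and> odd k) \<or> (k mod 4 = 2 \<and> even k) \<or> (k mod 4 = 3 \<and> odd k)"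
    by presburger
  ultimately show ?case
    using IH mono[of k] Suc_mod by (elim disjE conjE) simp_all
qed

text \<open>Splitting off the even n reduces k to \<open>k div 2\<close>. Each halving loses at most
  ln k from the odd n, while the extra term ln 2 * \<open>psum (chi 1) (k div 2)\<close> is
  nonnegative; there are at most J halvings.\<close>

lemma sum_chi_ln_lower:
  assumes "k \<ge> 1" "k < 2 ^ J"
  shows "(\<Sum>n=1..k. of_int (cmult (chi 1) n) * ln (real n)) \<ge> - real J * ln (real k)"
  using assms
proof (induction J arbitrary: k)
  case (Suc J)
  let ?T = "\<lambda>k. \<Sum>n=1..k. of_int (cmult (chi 1) n) * ln (real n)"
  have mono: "ln (real n) \<le> ln (real (Suc n))" for n
    by (cases "n = 0") auto
  have ln_k: "ln (real k) \<ge> 0" using Suc.prems by simp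
  have odd: "(\<Sum>n | n \<in> {1..k} \<and> odd n. of_int (cmult (chi 1) n) * ln (real n)) \<ge> - ln (real k)"
    using alternating_sum_lower[of "\<lambda>n. ln (real n)" k 1, OF mono] ln_k by (simp split: if_splits del: atLeastAtMost_iff)
  have "(\<Sum>m=1..k div 2. of_int (cmult (chi 1) (2 * m)) * ln (real (2 * m)))
      = (\<Sum>m=1..k div 2. of_int (cmult (chi 1) m) * (ln 2 + ln (real m)))"
    by (intro sum.cong refl) (auto simp: cmult_mult cmult_prime chi_def[of 1 2] ln_mult)
  also have "\<dots> = ln 2 * of_int (psum (chi 1) (k div 2)) + ?T (k div 2)"
    by (simp add: psum_def sum.distrib distrib_left flip: sum_distrib_right)
  also have "\<dots> \<ge> - real J * ln (real k)"
  proof (cases "k div 2 = 0")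
    case True
    thus ?thesis using Suc.prems by simp
  next
    case False
    hence "?T (k div 2) \<ge> - real J * ln (real (k div 2))" using Suc by (intro Suc.IH) auto
    moreover have "real J * ln (real (k div 2)) \<le> real J * ln (real k)"
      using False by (intro mult_left_mono) auto
    moreover have "psum (chi 1) (k div 2) \<ge> 1" using False by (intro psum_chi_pos) auto
    hence "ln 2 * real_of_int (psum (chi 1) (k div 2)) \<ge> 0" by simp
    ultimately show ?thesis by linarith
  qed
  finally have even: "- real J * ln (real k) \<le>
      (\<Sum>m=1..k div 2. of_int (cmult (chi 1) (2 * m)) * ln (real (2 * m)))" .
  have "real (Suc J) * ln (real k) = real J * ln (real k) + ln (real k)" by (simp add: distrib_right)
  thus ?case using odd even unfolding sum_even_odd[of _ k] by linarith
qed simp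

section \<open>Lengths from 2^17 on\<close>

lemma abs_chi: "\<bar>e\<bar> = 1 \<Longrightarrow> \<bar>chi e p\<bar> = 1"
  by (simp add: chi_def)

text \<open>Source of the threshold 2^17: 328^2 = 107584 <= 2^17 for J = 18, whereas J = 17 fails. A
  step multiplies the left side by at most 49/25 < 2.\<close>

lemma power_two_lower:
  fixes J :: nat
  assumes "J \<ge> 18"
  shows "(J\<^sup>2 + 4)\<^sup>2 \<le> 2 ^ (J - 1)"
  using assms
proof (induction J rule: dec_induct)
  case (step J)
  have "18 * J \<le> J * J" using step.hyps by (intro mult_right_mono) auto
  hence "10 * J \<le> 2 * (J * J) + 3" by linarith
  hence "5 * ((Suc J)\<^sup>2 + 4) \<le> 7 * (J\<^sup>2 + 4)"
    by (simp add: power2_eq_square)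
  hence "(5 * ((Suc J)\<^sup>2 + 4))\<^sup>2 \<le> (7 * (J\<^sup>2 + 4))\<^sup>2"
    by (rule power_mono) simp
  hence "25 * ((Suc J)\<^sup>2 + 4)\<^sup>2 \<le> 49 * (J\<^sup>2 + 4)\<^sup>2"
    unfolding power_mult_distrib by simp
  moreover have "(2::nat) ^ (Suc J - 1) = 2 * 2 ^ (J - 1)"
    using step.hyps by (cases J) auto
  ultimately show ?case using step.IH by linarith
qed simp

lemma balance_large:
  assumes k: "2 ^ 17 \<le> k"
  shows "\<exists>s'. (\<forall>p. prime p \<longrightarrow> \<bar>s' p\<bar> = 1) \<and> \<bar>psum s' k\<bar> \<le> 1"
proof -
  have k0: "k > 0" using k by (auto intro: Nat.gr0I)
  obtain m where m: "2 ^ m \<le> k" "k < 2 ^ (m + 1)"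
    using ex_power_ivl1[of 2 k] k0 by auto
  \<comment> \<open>The number of binary digits of k, which bounds all the weights.\<close>
  define J where "J = m + 1"
  have kJ: "2 ^ (J - 1) \<le> k" "k < 2 ^ J"
    using m by (simp_all add: J_def)
  have J: "J \<ge> 18"
  proof (rule ccontr)
    assume "\<not> J \<ge> 18"
    hence "(2::nat) ^ J \<le> 2 ^ 17" by (intro power_increasing) auto
    thus False using k kJ(2) by linarith
  qed
  define r where "r = sqrt (real k)"
  define n where "n = k div 2"
  have n: "n \<ge> 2" "2 * n \<le> k" "k \<le> 2 * n + 1" using k by (auto simp: n_def)
  have r: "(real J)\<^sup>2 + 4 \<le> r" "r * r = real k"
  proof -
    have "(J\<^sup>2 + 4)\<^sup>2 \<le> k" using power_two_lower[OF J] kJ by linarith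
    hence "real ((J\<^sup>2 + 4)\<^sup>2) \<le> real k" by (rule of_nat_mono)
    thus "(real J)\<^sup>2 + 4 \<le> r" unfolding r_def by (intro real_le_rsqrt) (simp add: add.commute)
  qed (simp add: r_def)
  define l where "l = ln (real k)"
  have l: "l > 0" "l \<le> real J * ln 2" "ln (2 * real n) \<le> l"
  proof -
    show "l > 0" using k by (simp add: l_def)
    have "l \<le> ln (2 ^ J)" unfolding l_def
      using of_nat_mono[OF less_imp_le[OF kJ(2)], where 'a = real] k0 by (intro ln_mono) auto
    thus "l \<le> real J * ln 2" by (simp add: ln_realpow)
    show "ln (2 * real n) \<le> l" unfolding l_def using n by (intro ln_mono) auto
  qed
  have ln4: "ln (4::real) = 2 * ln 2" using ln_realpow[of 2 2] by simp
  have ln2: "ln (2::real) > 0" by simp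
  let ?L = "large_primes k"
  let ?w = "\<lambda>d. psum (chi 1) (k div d)"
  let ?f = "cmult (chi 1)"
  let ?Q = "{p. prime p \<and> p \<le> k \<and> k < 2 * p}"
  have w: "1 \<le> ?w d" "?w d \<le> int J" if "d \<in> {1..k}" for d
  proof -
    show "1 \<le> ?w d" using that by (intro psum_chi_pos) (simp add: div_greater_zero_iff)
    have "k div d < 2 ^ J" using kJ(2) div_le_dividend[of k d] by linarith
    thus "?w d \<le> int J" by (rule psum_chi_le)
  qed
  have f: "\<bar>?f d\<bar> = 1" for d by (intro abs_cmult abs_chi) simp
  have rest: "(\<Sum>d\<in>{1..k} - ?L. mangoldt d) \<le> (r + 1) / 2 * l"
    using mangoldt_sum_not_large_primes[of k] k0 by (simp add: r_def l_def)
  have L_sub: "?L \<subseteq> {1..k}" by (auto simp: large_primes_def prime_gt_0_nat Suc_le_eq)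

  have "real J \<le> real (card ?Q)"
  proof (rule ccontr)
    assume "\<not> real J \<le> real (card ?Q)"
    hence less: "real (card ?Q) \<le> real J" by simp
    have finQ: "finite ?Q" by (rule finite_subset[of _ "{..k}"]) auto
    have "real n / 3 * ln 4 - ln (2 * real n) \<le> (\<Sum>d=n+1..n+n. mangoldt d)"
      using n by (intro mangoldt_sum_upper_half)
    \<comment> \<open>A large prime d > n lies in the upper half because k <= 2n + 1 < 2d.\<close>
    also have "\<dots> \<le> (\<Sum>d\<in>?Q \<union> ({1..k} - ?L). mangoldt d)"
      using n finQ by (intro sum_mono2) (auto simp: mangoldt_nonneg large_primes_def)
    also have "\<dots> \<le> (\<Sum>d\<in>?Q. mangoldt d) + (\<Sum>d\<in>{1..k} - ?L. mangoldt d)"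
      using finQ by (subst sum.union_inter [symmetric]) (auto intro!: sum_nonneg mangoldt_nonneg)
    also have "(\<Sum>d\<in>?Q. mangoldt d) \<le> (\<Sum>d\<in>?Q. l)"
      by (intro sum_mono) (auto simp: l_def prime_gt_0_nat)
    also have "\<dots> \<le> real J * l" using less l by simp
    finally have "real n / 3 * ln 4 \<le> real J * l + (r + 1) / 2 * l + l"
      using rest l(3) by linarith
    hence "real n * 2 / 3 * ln 2 \<le> (real J + (r + 1) / 2 + 1) * l"
      by (simp add: ln4 distrib_right)
    also have "\<dots> \<le> (real J + (r + 1) / 2 + 1) * (real J * ln 2)"
      using l r by (intro mult_left_mono) (auto simp: r_def)
    finally have "real n * 2 / 3 * ln 2 \<le> ((real J + (r + 1) / 2 + 1) * real J) * ln 2" by simp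
    hence "real n * 2 / 3 \<le> (real J + (r + 1) / 2 + 1) * real J" using ln2 by (rule mult_right_le_imp_le)
    hence "4 * real n \<le> 6 * (real J * real J) + 3 * (real J * r) + 9 * real J"
      by (simp add: field_simps)
    hence "2 * (r * r) - 2 \<le> 6 * (real J * real J) + 3 * (real J * r) + 9 * real J"
      using n(3) r(2) by linarith
    moreover have "18 * real J \<le> real J * real J" using J by (intro mult_right_mono) auto
    moreover have "18 * real J \<le> r" using r calculation(2) by (simp add: power2_eq_square)
    moreover from this have "18 * real J * r \<le> r * r" "18 * real J * real J \<le> r * real J"
      using J by (auto intro: mult_right_mono)
    moreover have "real J \<ge> 18" using J by simp
    moreover have "r * real J = real J * r" by simp
    ultimately show False by linarith
  qed
  hence Q: "int J \<le> int (card ?Q)" by simp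

  \<comment> \<open>Twice the weight of the large primes of sign 1. As the partial sum at k is at
    most J, \<open>int J \<le> Y\<close> gives the hypothesis \<open>up\<close> of
    \<open>balance_greedily\<close>.\<close>
  define Y where "Y = (\<Sum>p\<in>?L. (1 + chi 1 p) * ?w p)"
  have "int J \<le> Y"
  proof (rule ccontr)
    assume "\<not> int J \<le> Y"
    hence less: "real_of_int Y \<le> real J" by simp
    \<comment> \<open>Adding the untwisted sum to the twisted one cancels every d of sign -1, while
      the untwisted sum supplies the main term of order k.\<close>
    let ?g = "\<lambda>d. mangoldt d * real_of_int ((1 + ?f d) * ?w d)"
    have lower: "real n * ln 4 - ln (2 * real n) - real J * l \<le> (\<Sum>d=1..k. ?g d)"
    proof -
      have "real n * ln 4 - ln (2 * real n) \<le> (\<Sum>d=1..n+n. mangoldt d)"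
        using n by (intro mangoldt_sum_lower) auto
      also have "\<dots> \<le> (\<Sum>d=1..k. mangoldt d)"
        using n by (intro sum_mono2) (auto simp: mangoldt_nonneg)
      also have "\<dots> \<le> (\<Sum>d=1..k. mangoldt d * real_of_int (?w d))"
      proof (intro sum_mono)
        fix d assume "d \<in> {1..k}"
        hence "1 \<le> real_of_int (?w d)" using w(1)[of d] by simp
        from mult_left_mono[OF this mangoldt_nonneg[of d]]
        show "mangoldt d \<le> mangoldt d * real_of_int (?w d)" by simp
      qed
      finally have "real n * ln 4 - ln (2 * real n) \<le> (\<Sum>d=1..k. mangoldt d * real_of_int (?w d))" .
      moreover have "- real J * l \<le> (\<Sum>d=1..k. mangoldt d * real_of_int (?f d * ?w d))"
        using sum_chi_ln_lower[of k J] k0 kJ(2) unfolding sum_cmult_ln l_def by simp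
      moreover have "(\<Sum>d=1..k. ?g d) = (\<Sum>d=1..k. mangoldt d * real_of_int (?w d)) +
          (\<Sum>d=1..k. mangoldt d * real_of_int (?f d * ?w d))"
        by (simp add: algebra_simps sum.distrib)
      ultimately show ?thesis by linarith
    qed
    have "(\<Sum>d=1..k. ?g d) = (\<Sum>d\<in>{1..k} - ?L. ?g d) + (\<Sum>d\<in>?L. ?g d)"
      by (rule sum.subset_diff[OF L_sub]) simp
    also have "(\<Sum>d\<in>{1..k} - ?L. ?g d) \<le> (\<Sum>d\<in>{1..k} - ?L. mangoldt d * (2 * real J))"
    proof (intro sum_mono mult_left_mono mangoldt_nonneg)
      fix d assume "d \<in> {1..k} - ?L"
      hence "(1 + ?f d) * ?w d \<le> 2 * int J"
        using w[of d] f[of d] by (intro mult_mono) auto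
      thus "real_of_int ((1 + ?f d) * ?w d) \<le> 2 * real J" by linarith
    qed
    also have "\<dots> = (\<Sum>d\<in>{1..k} - ?L. mangoldt d) * (2 * real J)"
      by (simp add: sum_distrib_right)
    also have "\<dots> \<le> ((r + 1) / 2 * l) * (2 * real J)"
      by (intro mult_right_mono rest) simp
    also have "(\<Sum>d\<in>?L. ?g d) \<le> (\<Sum>p\<in>?L. l * real_of_int ((1 + chi 1 p) * ?w p))"
    proof (intro sum_mono)
      fix p assume p: "p \<in> ?L"
      hence pp: "prime p" "p \<le> k" "p > 0" by (auto simp: large_primes_def prime_gt_0_nat)
      have "0 \<le> (1 + chi 1 p) * ?w p"
        using w(1)[of p] p L_sub abs_chi[of 1 p] by (intro mult_nonneg_nonneg) auto
      moreover have "ln (real p) \<le> l" using pp by (simp add: l_def)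
      ultimately show "?g p \<le> l * real_of_int ((1 + chi 1 p) * ?w p)"
        using pp by (simp add: cmult_prime mult_right_mono del: of_int_mult)
    qed
    also have "\<dots> = l * real_of_int Y" by (simp add: Y_def sum_distrib_left)
    also have "\<dots> \<le> l * real J" using less l by (intro mult_left_mono) auto
    finally have "(\<Sum>d=1..k. ?g d) \<le> (r + 1) / 2 * l * (2 * real J) + l * real J" by simp
    moreover have "(r + 1) / 2 * l * (2 * real J) = (real J * r + real J) * l" by (simp add: field_simps)
    ultimately have "real n * ln 4 \<le> (real J * r + real J) * l + l * real J + real J * l + l"
      using lower l(3) by linarith
    also have "\<dots> = (real J * r + 3 * real J + 1) * l" by (simp add: algebra_simps)
    finally have "real n * ln 4 \<le> (real J * r + 3 * real J + 1) * l" .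
    also have "\<dots> \<le> (real J * r + 3 * real J + 1) * (real J * ln 2)"
      using l r by (intro mult_left_mono) (auto simp: r_def)
    finally have "(2 * real n) * ln 2 \<le> ((real J * r + 3 * real J + 1) * real J) * ln 2"
      by (simp add: ln4)
    hence "2 * real n \<le> (real J * r + 3 * real J + 1) * real J" using ln2 by (rule mult_right_le_imp_le)
    \<comment> \<open>The term 4 in \<open>r(1)\<close> decides: r^2 >= J^2 r + 4r, and 4r >= 4J^2 +
      16 exceeds 3J^2 + J + 1.\<close>
    hence "r * r - 1 \<le> (real J)\<^sup>2 * r + 3 * (real J)\<^sup>2 + real J"
      using n r by (simp add: algebra_simps power2_eq_square)
    moreover have "((real J)\<^sup>2 + 4) * r \<le> r * r" using r by (intro mult_right_mono) (auto simp: r_def)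
    moreover have "((real J)\<^sup>2 + 4) * r = (real J)\<^sup>2 * r + 4 * r" by (simp add: algebra_simps)
    moreover have "real J \<le> (real J)\<^sup>2" using J by (simp add: power2_eq_square)
    moreover have "real J \<ge> 0" by simp
    ultimately show False using r(1) by linarith
  qed
  hence up: "psum (chi 1) k \<le> Y" using psum_chi_le[OF kJ(2)] by linarith
  have wL: "0 \<le> ?w p" "?w p \<le> int J" if "p \<in> ?L" for p
    using w[of p] that L_sub by auto
  have lo: "- psum (chi 1) k \<le> (\<Sum>p\<in>?L. (1 - chi 1 p) * ?w p)"
  proof -
    have "0 \<le> (\<Sum>p\<in>?L. (1 - chi 1 p) * ?w p)"
      using wL(1) by (intro sum_nonneg mult_nonneg_nonneg) (auto simp: chi_def)
    thus ?thesis using psum_chi_pos[OF k0] by linarith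
  qed
  show ?thesis
    by (rule balance_greedily[OF _ wL Q up[unfolded Y_def] lo]) (simp_all add: abs_chi)
qed

section \<open>Flipping explicit primes in (k/2, k]\<close>

lemma balance_by_flips:
  assumes e: "\<bar>e\<bar> = 1" and \<sigma>: "\<bar>\<sigma>\<bar> = 1" and Q: "finite Q"
    "\<And>q. q \<in> Q \<Longrightarrow> prime q \<and> chi e q = \<sigma> \<and> q \<le> k \<and> k < 2 * q"
    and bound: "-1 \<le> \<sigma> * psum (chi e) k" "\<sigma> * psum (chi e) k \<le> 2 * int (card Q) + 1"
  shows "\<exists>s'. (\<forall>p. prime p \<longrightarrow> \<bar>s' p\<bar> = 1) \<and> \<bar>psum s' k\<bar> \<le> 1"
proof -
  \<comment> \<open>Each flip lowers \<open>\<sigma> * psum (chi e) k\<close> by 2, so m flips leave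
    0 or 1. For the value -1 the function \<open>nat\<close> gives m = 0, and nothing needs to be
    flipped.\<close>
  define m where "m = nat (\<sigma> * psum (chi e) k div 2)"
  have "m \<le> card Q" using bound by (simp add: m_def)
  then obtain R where R: "R \<subseteq> Q" "card R = m" by (meson obtain_subset_with_card_n)
  have finR: "finite R" using R(1) Q(1) by (rule finite_subset)
  define s' where "s' = (\<lambda>p. if p \<in> R then - chi e p else chi e p)"
  have RL: "R \<subseteq> large_primes k" using R Q upper_half_subset_large_primes[of k] by blast
  have "psum s' k = psum (chi e) k + (\<Sum>p\<in>large_primes k. (s' p - chi e p) * psum (chi e) (k div p))"
    using RL by (intro psum_change_signs) (auto simp: s'_def)
  also have "(\<Sum>p\<in>large_primes k. (s' p - chi e p) * psum (chi e) (k div p)) = (\<Sum>p\<in>R. - 2 * \<sigma>)"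
  proof (rule sum.mono_neutral_cong_right)
    fix p assume "p \<in> R"
    hence "chi e p = \<sigma>" "k div p = 1" using R Q upper_half_div[of p k] by auto
    thus "(s' p - chi e p) * psum (chi e) (k div p) = - 2 * \<sigma>"
      using \<open>p \<in> R\<close> by (simp add: s'_def)
  qed (use RL in \<open>auto simp: s'_def\<close>)
  finally have eq: "psum s' k = psum (chi e) k - 2 * \<sigma> * int m" using R by simp
  have "\<sigma> = 1 \<or> \<sigma> = -1" using \<sigma> by linarith
  hence "\<bar>psum s' k\<bar> \<le> 1" using bound unfolding eq m_def by (elim disjE) (simp_all, presburger+)
  moreover have "\<forall>p. prime p \<longrightarrow> \<bar>s' p\<bar> = 1" using e by (simp add: s'_def abs_chi)
  ultimately show ?thesis by blast
qed

section \<open>Small lengths\<close>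

text \<open>A divisor d > 1 of n with d^2 <= n is odd and smaller than 2m + 3, the first odd number
  not tried.\<close>

lemma prime_by_trial_division:
  fixes n m :: int
  assumes "odd n" "n > 1" "n < (2 * m + 3)\<^sup>2" "m \<ge> 0" "\<forall>i\<in>{1..m}. \<not> (2 * i + 1) dvd n"
  shows "prime (nat n)"
  unfolding prime_divisor_sqrt
proof (intro conjI allI impI)
  fix d assume d: "d dvd nat n \<and> d\<^sup>2 \<le> nat n"
  define i where "i = (int d - 1) div 2"
  have dvd: "int d dvd n" using d assms(2) by (simp add: int_dvd_int_iff [symmetric])
  hence "odd (int d)" using assms(1) by auto
  hence i: "int d = 2 * i + 1" "i \<ge> 0" unfolding i_def by presburger+
  have "(int d)\<^sup>2 < (2 * m + 3)\<^sup>2" using d assms(2,3) by (simp add: le_nat_iff)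
  hence "int d < 2 * m + 3" by (rule power_less_imp_less_base) (use assms(4) in simp)
  hence "i \<le> m" using i by simp
  hence "\<not> i \<ge> 1" using assms(5) dvd i by auto
  thus "d = 1" using i by linarith
qed (use assms in auto)

text \<open>\<open>qs\<close> are primes congruent to 1 modulo 4 that lie in \<open>(k/2, k]\<close> for every \<open>k\<close> from \<open>a\<close> to \<open>b\<close>, and
  there are enough of them because the partial sum to be halved is at most the number of binary digits
  of \<open>k\<close>; trial division by \<open>3, 5, \<dots>, 2 m + 1\<close> shows that they are prime. Integers are used because
  \<open>code_simp\<close> evaluates \<open>nat\<close> in unary.\<close>

definition flip_certificate :: "int \<Rightarrow> int list \<Rightarrow> int \<Rightarrow> int \<Rightarrow> bool" where
  "flip_certificate m qs a b \<longleftrightarrow> distinct qs \<and> b < 2 ^ (2 * length qs + 1) \<and> m \<ge> 0 \<and>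
     list_all (\<lambda>q. 1 < q \<and> q mod 4 = 1 \<and> q \<le> a \<and> b < 2 * q \<and> q < (2 * m + 3)\<^sup>2 \<and>
       list_all (\<lambda>i. \<not> (2 * i + 1) dvd q) [1..m]) qs"

lemma balance_by_certificate:
  assumes cert: "flip_certificate m qs a b" and k: "a \<le> int k" "int k \<le> b"
  shows "\<exists>s'. (\<forall>p. prime p \<longrightarrow> \<bar>s' p\<bar> = 1) \<and> \<bar>psum s' k\<bar> \<le> 1"
proof -
  have qs: "1 < q" "q mod 4 = 1" "q \<le> a" "b < 2 * q" "prime (nat q)" if "q \<in> set qs" for q
  proof -
    show *: "1 < q" "q mod 4 = 1" "q \<le> a" "b < 2 * q"
      using that cert by (auto simp: flip_certificate_def list_all_iff)
    have "odd q" using *(2) by presburger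
    thus "prime (nat q)" using that cert
      by (intro prime_by_trial_division[of q m]) (auto simp: flip_certificate_def list_all_iff)
  qed
  have "inj_on nat (set qs)" using qs(1) by (intro inj_onI) force
  hence card: "card (nat ` set qs) = length qs"
    using cert by (simp add: card_image flip_certificate_def distinct_card)
  have "int k < 2 ^ (2 * length qs + 1)" using cert k by (simp add: flip_certificate_def)
  hence "int k < int (2 ^ (2 * length qs + 1))" by simp
  hence "k < 2 ^ (2 * length qs + 1)" by (simp only: of_nat_less_iff)
  hence le: "psum (chi 1) k \<le> int (2 * length qs + 1)" by (rule psum_chi_le)
  have ge: "psum (chi 1) k \<ge> 0" using psum_chi_pos[of k] by (cases "k = 0") auto
  show ?thesis
  proof (rule balance_by_flips[of 1 1 "nat ` set qs"])
    fix p assume "p \<in> nat ` set qs"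
    then obtain q where q: "q \<in> set qs" "p = nat q" by blast
    have "int p = q" using qs(1)[OF q(1)] q(2) by simp
    hence "p mod 4 = 1" "p \<noteq> 2" using qs(2)[OF q(1)] by presburger+
    thus "prime p \<and> chi 1 p = 1 \<and> p \<le> k \<and> k < 2 * p"
      using qs[OF q(1)] k \<open>int p = q\<close> q(2) by (auto simp: chi_def)
  qed (use le ge card in auto)
qed

fun flip_chain :: "int \<Rightarrow> (int \<times> int list \<times> int) list \<Rightarrow> int \<Rightarrow> bool" where
  "flip_chain a [] c \<longleftrightarrow> c < a"
| "flip_chain a ((m, qs, b) # cs) c \<longleftrightarrow> flip_certificate m qs a b \<and> flip_chain (b + 1) cs c"

lemma balance_by_chain:
  assumes "flip_chain a cs c" "a \<le> int k" "int k \<le> c"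
  shows "\<exists>s'. (\<forall>p. prime p \<longrightarrow> \<bar>s' p\<bar> = 1) \<and> \<bar>psum s' k\<bar> \<le> 1"
  using assms
proof (induction cs arbitrary: a)
  case (Cons x cs)
  obtain m qs b where x: "x = (m, qs, b)" by (cases x)
  show ?case
  proof (cases "int k \<le> b")
    case True
    thus ?thesis using Cons.prems balance_by_certificate[of m qs a b k] by (simp add: x)
  next
    case False
    thus ?thesis using Cons.prems by (intro Cons.IH[of "b + 1"]) (simp_all add: x)
  qed
qed simp

text \<open>Restricted to numerals, the recursion is a terminating rewrite rule that ends at
  \<open>psum_1\<close>.\<close>

lemma psum_chi_numeral:
  "psum (chi e) (numeral n) = e * psum (chi e) (numeral n div 2) +
     (if numeral n mod (4 :: nat) = 1 \<or> numeral n mod (4 :: nat) = 2 then 1 else 0)"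
  by (rule psum_chi_rec)

text \<open>With \<open>f 2 = 1\<close> no suitable flips exist for a few small \<open>k\<close>, for instance \<open>k = 2\<close>; hence \<open>f 2 = -1\<close>.\<close>

lemma balance_small:
  assumes k: "1 \<le> k" "k < 44"
  shows "\<exists>s'. (\<forall>p. prime p \<longrightarrow> \<bar>s' p\<bar> = 1) \<and> \<bar>psum s' k\<bar> \<le> 1"
proof -
  have flip: ?thesis if "a \<le> k" "k < b" "\<bar>\<sigma>\<bar> = 1"
    "list_all (\<lambda>q. prime q \<and> chi (-1) q = \<sigma> \<and> q \<le> a \<and> b \<le> 2 * q) qs" "distinct qs"
    "list_all (\<lambda>j. -1 \<le> \<sigma> * psum (chi (-1)) j \<and> \<sigma> * psum (chi (-1)) j \<le> 2 * int (length qs) + 1) [a..<b]"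
    for a b \<sigma> qs
    using that
    by (intro balance_by_flips[of "-1" \<sigma> "set qs"]) (auto simp: list_all_iff distinct_card)
  note simps = psum_chi_numeral chi_def
  consider "1 \<le> k" "k < 2" | "2 \<le> k" "k < 6" | "6 \<le> k" "k < 10" | "10 \<le> k" "k < 14" | "14 \<le> k" "k < 26" | "26 \<le> k" "k < 34" | "34 \<le> k" "k < 44"
    using k by linarith
  thus ?thesis
  proof cases
    case 1
    hence "k = 1" by simp
    thus ?thesis by (intro exI[of _ "\<lambda>_. 1"]) simp
  next
    case 2 show ?thesis by (rule flip[OF 2, of 1 "[]"]) (simp_all add: simps)
  next
    case 3 show ?thesis by (rule flip[OF 3, of 1 "[5]"]) (simp_all add: simps)
  next
    \<comment> \<open>Here the partial sum falls to -2 at k = 12, so a prime of sign -1 is flipped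
      to raise it.\<close>
    case 4 show ?thesis by (rule flip[OF 4, of "-1" "[7]"]) (simp_all add: simps)
  next
    case 5 show ?thesis by (rule flip[OF 5, of 1 "[13]"]) (simp_all add: simps)
  next
    case 6 show ?thesis by (rule flip[OF 6, of 1 "[17]"]) (simp_all add: simps)
  next
    case 7 show ?thesis by (rule flip[OF 7, of 1 "[29]"]) (simp_all add: simps)
  qed
qed

lemma balance_medium:
  assumes "44 \<le> k" "k < 2 ^ 17"
  shows "\<exists>s'. (\<forall>p. prime p \<longrightarrow> \<bar>s' p\<bar> = 1) \<and> \<bar>psum s' k\<bar> \<le> 1"
proof -
  \<comment> \<open>Each block ends at twice its smallest prime minus 1, the last k for which that
    prime exceeds k/2; only the final block is cut off at 2^17 - 1.\<close>
  have "flip_chain 44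
     [(2, [29, 37, 41], 57),
      (3, [37, 41, 53], 73),
      (3, [53, 61, 73], 105),
      (4, [73, 89, 97, 101], 145),
      (5, [101, 109, 113, 137], 201),
      (6, [173, 181, 193, 197], 345),
      (8, [281, 293, 313, 317, 337], 561),
      (11, [461, 509, 521, 541, 557], 921),
      (14, [829, 853, 857, 877, 881], 1657),
      (19, [1601, 1609, 1613, 1621, 1637, 1657], 3201),
      (27, [3089, 3109, 3121, 3137, 3169, 3181], 6177),
      (38, [6073, 6089, 6101, 6113, 6121, 6133, 6173], 12145),
      (54, [12041, 12049, 12073, 12097, 12101, 12109, 12113], 24081),
      (77, [23977, 23981, 23993, 24001, 24029, 24049, 24061, 24077], 47953),
      (108, [47797, 47809, 47837, 47857, 47869, 47881, 47917, 47933], 95593),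
      (127, [65537, 65557, 65581, 65609, 65617, 65629, 65633, 65657], 131071)] 131071"
    by code_simp
  thus ?thesis by (rule balance_by_chain) (use assms in simp_all)
qed

theorem theorem1:
  fixes k :: nat
  assumes "k \<ge> 1"
  shows "\<exists>c :: nat \<Rightarrow> colour. \<forall>s\<ge>1. perfectly_balanced c (hap s k)"
proof -
  consider "k < 44" | "44 \<le> k" "k < 2 ^ 17" | "2 ^ 17 \<le> k" by linarith
  hence "\<exists>s'. (\<forall>p. prime p \<longrightarrow> \<bar>s' p\<bar> = 1) \<and> \<bar>psum s' k\<bar> \<le> 1"
    using assms by cases (auto intro: balance_small balance_medium balance_large)
  thus ?thesis using colouring_of_psum by blast
qed

end
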